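(* Let $\Bbbk$ be a field, let $p\in\Bbbk$ with $p^2=-1$, and let $\mathbb{B}$ be the $\Bbbk$-algebra generated by $y_1,y_2,x_1,x_2$ subject to the relations $$x_2x_1=p\,x_1x_2,\quad y_2y_1=p\,y_1y_2,\quad y_1x_1=x_2y_2,\quad y_1x_2=x_1y_2,\quad y_2x_1=-x_2y_1,\quad y_2x_2=x_1y_1.$$ Let $S\subset\Bbbk\{y_1,y_2,x_1,x_2\}$ be the set consisting of the six polynomials $$x_2x_1-p\,x_1x_2,\quad y_2y_1-p\,y_1y_2,\quad x_2y_2-y_1x_1,\quad x_1y_2-y_1x_2,\quad x_2y_1+y_2x_1,\quad x_1y_1-y_2x_2.$$ Then, with respect to the degree lexicographic order with $y_1\prec y_2\prec x_1\prec x_2$, the set $S$ is a Gröbner-Shirshov basis of the ideal $\mathrm{Id}(S)$, which is the ideal of defining relations of $\mathbb{B}$, i.e. $\mathbb{B}=\Bbbk\{y_1,y_2,x_1,x_2\}/\mathrm{Id}(S)$.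
   Context: Let $X=\{y_1,y_2,x_1,x_2\}$, let $X^*$ be the free monoid of words in $X$, and let $\Bbbk\{X\}$ be the free associative unital $\Bbbk$-algebra on $X$ (noncommutative polynomials). $\mathrm{Id}(S)$ denotes the two-sided ideal of $\Bbbk\{X\}$ generated by $S$. The degree lexicographic order $\prec$ on $X^*$ compares words first by length and then, for equal length, lexicographically from left to right with $y_1\prec y_2\prec x_1\prec x_2$. For a nonzero $f\in\Bbbk\{X\}$, $\overline{f}$ denotes its leading (i.e. $\prec$-largest) word; $f$ is monic if the coefficient of $\overline{f}$ is $1$. For monic $f,g$: (i) if $w=\overline{f}a=b\overline{g}$ with $a,b\in X^*$ and $|\overline{f}|+|\overline{g}|>|w|$, then $(f,g)_w:=fa-bg$ is the intersection composition; (ii) if $w=\overline{f}=a\overline{g}b$ with $a,b\in X^*$, then $(f,g)_w:=f-agb$ is the inclusion composition. A composition $(f,g)_w$ is trivial modulo $S$ if $(f,g)_w=\sum_i\alpha_i a_is_ib_i$ (finite sum) with $\alpha_i\in\Bbbk$, $a_i,b_i\in X^*$, $s_i\in S$ and $a_i\overline{s_i}b_i\prec w$ for all $i$. A nonempty set $S$ of monic polynomials is a Gröbner-Shirshov basis of $\mathrm{Id}(S)$ if every composition $(f,g)_w$ with $f,g\in S$ is trivial modulo $S$. *)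

theory Defs
  imports
    "HOL-Library.Poly_Mapping"
    "HOL-Library.List_Lenlexorder"
    "HOL-Algebra.QuotRing"
    "HOL-Algebra.Module"
begin

section \<open>The free associative algebra\<close>

text \<open>
  \<^theory>\<open>HOL-Library.Poly_Mapping\<close> multiplies finitely supported functions by convolution over an
  additively written monoid of exponents. Viewing lists under concatenation as such a (noncommutative)
  additive monoid makes \<^typ>\<open>'x list \<Rightarrow>\<^sub>0 'k\<close> the free associative unital algebra on \<^typ>\<open>'x\<close>.
\<close>

instantiation list :: (type) monoid_add
begin

definition zero_list :: "'a list" where "zero_list = []"

definition plus_list :: "'a list \<Rightarrow> 'a list \<Rightarrow> 'a list" where "plus_list = (@)"

instance by standard (simp_all add: zero_list_def plus_list_def)

end

type_synonym ('x, 'k) ncpoly = "'x list \<Rightarrow>\<^sub>0 'k"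

definition word :: "'x list \<Rightarrow> ('x, 'k::field) ncpoly"
  where "word u = Poly_Mapping.single u 1"

lemma word_append: "word (u @ v) = word u * word v"
  by (simp add: word_def mult_single plus_list_def)

definition scale :: "'k::field \<Rightarrow> ('x, 'k) ncpoly \<Rightarrow> ('x, 'k) ncpoly"
  where "scale c f = Poly_Mapping.single [] c * f"

definition free_algebra :: "('k::field, ('x, 'k) ncpoly) module"
  where "free_algebra =
    \<lparr>carrier = UNIV, mult = (*), one = 1, zero = 0, add = (+), smult = scale\<rparr>"

lemma ring_free_algebra: "ring (free_algebra :: ('k::field, ('x, 'k) ncpoly) module)"
proof (rule ringI)
  show "abelian_group (free_algebra :: ('k, ('x, 'k) ncpoly) module)"
  proof (rule abelian_groupI)
    fix x :: "('x, 'k) ncpoly"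
    show "\<exists>y\<in>carrier free_algebra. y \<oplus>\<^bsub>free_algebra\<^esub> x = \<zero>\<^bsub>free_algebra\<^esub>"
      by (rule bexI[of _ "- x"]) (simp_all add: free_algebra_def)
  qed (simp_all add: free_algebra_def add_ac)
  show "Group.monoid (free_algebra :: ('k, ('x, 'k) ncpoly) module)"
    by (rule monoidI) (simp_all add: free_algebra_def mult.assoc)
qed (simp_all add: free_algebra_def algebra_simps)

definition gen_ideal :: "('x, 'k::field) ncpoly set \<Rightarrow> ('x, 'k) ncpoly set"
  where "gen_ideal T = Idl\<^bsub>free_algebra\<^esub> T"

text \<open>The quotient ring, with the induced scalar multiplication on cosets.\<close>

definition quotient_algebra :: "('k, 'a) module \<Rightarrow> 'a set \<Rightarrow> ('k, 'a set) module"
  where "quotient_algebra A I =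
    ring.extend (A Quot I) (module.fields (\<lambda>c X. \<Union>x\<in>X. I +>\<^bsub>A\<^esub> (c \<odot>\<^bsub>A\<^esub> x)))"

text \<open>A relation \<open>l = r\<close> is given as the pair \<open>(l, r)\<close>.\<close>

definition relation_ideal ::
  "(('x, 'k::field) ncpoly \<times> ('x, 'k) ncpoly) set \<Rightarrow> ('x, 'k) ncpoly set"
  where "relation_ideal R = gen_ideal {l - r | l r. (l, r) \<in> R}"

definition presented_algebra ::
  "(('x, 'k::field) ncpoly \<times> ('x, 'k) ncpoly) set \<Rightarrow> ('k, ('x, 'k) ncpoly set) module"
  where "presented_algebra R = quotient_algebra free_algebra (relation_ideal R)"

section \<open>Groebner--Shirshov bases\<close>

text \<open>
  Words are compared with the order of \<^theory>\<open>HOL-Library.List_Lenlexorder\<close>, which is the degree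
  lexicographic order induced by the order on the letters.
\<close>

definition lead_word :: "('x::linorder, 'k::field) ncpoly \<Rightarrow> 'x list"
  where "lead_word f = Max (Poly_Mapping.keys f)"

definition monic :: "('x::linorder, 'k::field) ncpoly \<Rightarrow> bool"
  where "monic f \<longleftrightarrow> f \<noteq> 0 \<and> Poly_Mapping.lookup f (lead_word f) = 1"

definition intersection_composition ::
  "('x::linorder, 'k::field) ncpoly \<Rightarrow> ('x, 'k) ncpoly \<Rightarrow> 'x list \<Rightarrow> ('x, 'k) ncpoly \<Rightarrow> bool"
  where "intersection_composition f g w h \<longleftrightarrow>
    (\<exists>a b. w = lead_word f @ a \<and> w = b @ lead_word g \<and>
           length (lead_word f) + length (lead_word g) > length w \<and>
           h = f * word a - word b * g)"

definition inclusion_composition ::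
  "('x::linorder, 'k::field) ncpoly \<Rightarrow> ('x, 'k) ncpoly \<Rightarrow> 'x list \<Rightarrow> ('x, 'k) ncpoly \<Rightarrow> bool"
  where "inclusion_composition f g w h \<longleftrightarrow>
    (\<exists>a b. w = lead_word f \<and> w = a @ lead_word g @ b \<and> h = f - word a * g * word b)"

definition trivial_modulo ::
  "('x::linorder, 'k::field) ncpoly set \<Rightarrow> 'x list \<Rightarrow> ('x, 'k) ncpoly \<Rightarrow> bool"
  where "trivial_modulo T w h \<longleftrightarrow>
    (\<exists>ts :: ('k \<times> 'x list \<times> ('x, 'k) ncpoly \<times> 'x list) list.
       h = (\<Sum>(\<alpha>, a, s, b)\<leftarrow>ts. scale \<alpha> (word a * s * word b)) \<and>
       (\<forall>(\<alpha>, a, s, b)\<in>set ts. s \<in> T \<and> a @ lead_word s @ b < w))"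

text \<open>\<open>T\<close> is a Groebner--Shirshov basis of \<^term>\<open>gen_ideal T\<close>.\<close>

definition groebner_shirshov_basis :: "('x::linorder, 'k::field) ncpoly set \<Rightarrow> bool"
  where "groebner_shirshov_basis T \<longleftrightarrow>
    T \<noteq> {} \<and> (\<forall>f\<in>T. monic f) \<and>
    (\<forall>f\<in>T. \<forall>g\<in>T. \<forall>w h.
       intersection_composition f g w h \<or> inclusion_composition f g w h \<longrightarrow>
       trivial_modulo T w h)"

section \<open>The algebra \<open>B\<close>\<close>

datatype letter = Y1 | Y2 | X1 | X2

instantiation letter :: linorder
begin

fun letter_rank :: "letter \<Rightarrow> nat" where
  "letter_rank Y1 = 0"
| "letter_rank Y2 = 1"
| "letter_rank X1 = 2"
| "letter_rank X2 = 3"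

definition less_eq_letter :: "letter \<Rightarrow> letter \<Rightarrow> bool"
  where "a \<le> b \<longleftrightarrow> letter_rank a \<le> letter_rank b"

definition less_letter :: "letter \<Rightarrow> letter \<Rightarrow> bool"
  where "a < b \<longleftrightarrow> letter_rank a < letter_rank b"

instance
proof
  fix a b :: letter
  show "a = b" if "a \<le> b" "b \<le> a"
    using that by (cases a; cases b) (simp_all add: less_eq_letter_def)
qed (auto simp: less_eq_letter_def less_letter_def)

end

definition B_relations :: "'k::field \<Rightarrow> ((letter, 'k) ncpoly \<times> (letter, 'k) ncpoly) set"
  where "B_relations p =
    {(word [X2, X1], scale p (word [X1, X2])),
     (word [Y2, Y1], scale p (word [Y1, Y2])),
     (word [Y1, X1], word [X2, Y2]),
     (word [Y1, X2], word [X1, Y2]),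
     (word [Y2, X1], - word [X2, Y1]),
     (word [Y2, X2], word [X1, Y1])}"

definition B_algebra :: "'k::field \<Rightarrow> ('k, (letter, 'k) ncpoly set) module"
  where "B_algebra p = presented_algebra (B_relations p)"

definition S_set :: "'k::field \<Rightarrow> (letter, 'k) ncpoly set"
  where "S_set p =
    {word [X2, X1] - scale p (word [X1, X2]),
     word [Y2, Y1] - scale p (word [Y1, Y2]),
     word [X2, Y2] - word [Y1, X1],
     word [X1, Y2] - word [Y1, X2],
     word [X2, Y1] + word [Y2, X1],
     word [X1, Y1] - word [Y2, X2]}"

end

theory Submission
  imports Defs
begin

text \<open>
  All six relations of \<open>S\<close> have a leading word of length two, and the leading words are pairwise
  distinct, namely
  \<open>x\<^sub>2x\<^sub>1\<close>, \<open>y\<^sub>2y\<^sub>1\<close>, \<open>x\<^sub>2y\<^sub>2\<close>, \<open>x\<^sub>1y\<^sub>2\<close>, \<open>x\<^sub>2y\<^sub>1\<close> and \<open>x\<^sub>1y\<^sub>1\<close>.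
  Hence an inclusion, or an overlap in both letters, only pairs an element with itself and its
  composition is zero; what remains are overlaps in a single letter
  (\<open>quadratic_groebner_shirshov_basis\<close>). There are four of these, on the words \<open>x\<^sub>2x\<^sub>1y\<^sub>2\<close>,
  \<open>x\<^sub>2x\<^sub>1y\<^sub>1\<close>, \<open>x\<^sub>2y\<^sub>2y\<^sub>1\<close> and \<open>x\<^sub>1y\<^sub>2y\<^sub>1\<close>. In each of them the two ways of rewriting the word with the
  relations end in scalar multiples of one normal word, for example
  \<open>x\<^sub>2x\<^sub>1y\<^sub>2 \<rightarrow> p x\<^sub>1x\<^sub>2y\<^sub>2 \<rightarrow> p x\<^sub>1y\<^sub>1x\<^sub>1 \<rightarrow> p y\<^sub>2x\<^sub>2x\<^sub>1 \<rightarrow> p\<^sup>2 y\<^sub>2x\<^sub>1x\<^sub>2\<close> and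
  \<open>x\<^sub>2x\<^sub>1y\<^sub>2 \<rightarrow> x\<^sub>2y\<^sub>1x\<^sub>2 \<rightarrow> - y\<^sub>2x\<^sub>1x\<^sub>2\<close>,
  and the two scalars agree exactly because \<open>p\<^sup>2 = -1\<close>. Collecting the rewriting steps after the first
  one on either side expresses the composition through elements of \<open>S\<close> with leading terms below the
  overlap word.

  The elements of \<open>S\<close> are, up to sign, the differences of the two sides of the defining relations, so
  both sets generate the same ideal (\<open>gen_ideal_eqI\<close>).
\<close>

section \<open>Computing with linear combinations of words\<close>

text \<open>
  These rules move scalars outwards and merge words, so that an identity between noncommutative
  polynomials becomes one between linear combinations of words.
\<close>

lemma scale_add_right: "scale c (f + g) = scale c f + scale c g"
  by (simp add: scale_def distrib_left)

lemma scale_diff_right: "scale c (f - g) = scale c f - scale c g"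
  by (simp add: scale_def right_diff_distrib)

lemma scale_minus_left: "scale (- c) f = - scale c f"
  by (simp add: scale_def single_uminus)

lemma scale_one: "scale 1 f = f"
  by (simp add: scale_def single_one flip: zero_list_def)

lemma scale_scale: "scale c (scale d f) = scale (c * d) f"
  by (simp add: scale_def mult_single plus_list_def flip: mult.assoc)

lemma scale_mult_left: "scale c f * g = scale c (f * g)"
  by (simp add: scale_def mult.assoc)

lemma word_mult_scale: "word u * scale c f = scale c (word u * f)"
  by (simp add: scale_def word_def mult_single plus_list_def flip: mult.assoc)

lemma word_mult_word: "word u * word v = word (u @ v)"
  by (simp add: word_append)

lemma word_Nil: "word [] = 1"
  by (simp add: word_def single_one flip: zero_list_def)

lemmas word_algebra =
  scale_add_right scale_diff_right scale_minus_left scale_one scale_scale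
  scale_mult_left word_mult_scale word_mult_word
  distrib_left distrib_right left_diff_distrib right_diff_distrib

lemma scale_word: "scale c (word u) = Poly_Mapping.single u c"
  by (simp add: scale_def word_def mult_single plus_list_def)

lemma
  fixes u v :: "'x::linorder list"
  assumes "v < u"
  shows lead_word_binomial: "lead_word (word u + scale c (word v)) = u"
    and monic_binomial: "monic (word u + scale c (word v))"
proof -
  let ?f = "word u + scale c (word v)"
  have at_u: "Poly_Mapping.lookup ?f u = 1"
    using assms unfolding scale_word by (simp add: word_def lookup_add lookup_single)
  have "Poly_Mapping.keys ?f \<subseteq> {u, v}"
    unfolding scale_word by (rule order_trans[OF keys_add]) (auto simp: word_def)
  moreover have "u \<in> Poly_Mapping.keys ?f"
    using at_u by (simp add: in_keys_iff)
  ultimately show lead: "lead_word ?f = u"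
    unfolding lead_word_def using assms by (intro Max_eqI) auto
  show "monic ?f"
    unfolding monic_def lead using at_u by auto
qed

section \<open>Compositions of quadratic relations\<close>

text \<open>
  Leading words of length two are too short to be nested properly, and two distinct ones overlap in
  one letter at most. By injectivity every other composition is that of an element with itself.
\<close>

lemma quadratic_groebner_shirshov_basis:
  fixes T :: "('x::linorder, 'k::field) ncpoly set"
  assumes nonempty: "T \<noteq> {}"
    and monic: "\<And>f. f \<in> T \<Longrightarrow> monic f"
    and quadratic: "\<And>f. f \<in> T \<Longrightarrow> length (lead_word f) = 2"
    and inj: "inj_on lead_word T"
    and overlap: "\<And>f g x y z. f \<in> T \<Longrightarrow> g \<in> T \<Longrightarrow> lead_word f = [x, y] \<Longrightarrow> lead_word g = [y, z] \<Longrightarrow>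
      trivial_modulo T [x, y, z] (f * word [z] - word [x] * g)"
  shows "groebner_shirshov_basis T"
proof -
  have trivial_zero: "trivial_modulo T w 0" for w
    unfolding trivial_modulo_def by (rule exI[of _ "[]"]) simp
  have inter: "trivial_modulo T w h"
    if f: "f \<in> T" and g: "g \<in> T" and comp: "intersection_composition f g w h" for f g w h
  proof -
    from comp obtain a b where w: "w = lead_word f @ a" "w = b @ lead_word g"
      and short: "length w < length (lead_word f) + length (lead_word g)"
      and h: "h = f * word a - word b * g"
      unfolding intersection_composition_def by blast
    obtain x y where xy: "lead_word f = [x, y]"
      using quadratic[OF f] by (auto simp: length_Suc_conv numeral_2_eq_2)
    obtain y' z where yz: "lead_word g = [y', z]"
      using quadratic[OF g] by (auto simp: length_Suc_conv numeral_2_eq_2)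
    have len: "length a = length b" "length a < 2"
      using w short xy yz by (auto dest: arg_cong[of _ _ length])
    show ?thesis
    proof (cases a)
      case Nil
      then have "b = []" "f = g"
        using len w inj f g by (auto simp: inj_on_def)
      then show ?thesis
        using Nil h trivial_zero by (simp add: word_Nil)
    next
      case (Cons c a')
      then have "a = [c]" using len(2) by simp
      moreover obtain d where "b = [d]"
        using len(1) \<open>a = [c]\<close> by (cases b) auto
      ultimately have "w = [x, y, z]" "a = [z]" "b = [x]" "y' = y"
        using w xy yz by auto
      then show ?thesis
        using overlap[OF f g xy] yz h by simp
    qed
  qed
  have incl: "trivial_modulo T w h"
    if f: "f \<in> T" and g: "g \<in> T" and comp: "inclusion_composition f g w h" for f g w h
  proof -
    from comp obtain a b where w: "lead_word f = a @ lead_word g @ b"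
      and h: "h = f - word a * g * word b"
      unfolding inclusion_composition_def by blast
    have "a = []" "b = []"
      using arg_cong[OF w, of length] quadratic[OF f] quadratic[OF g] by auto
    then have "h = 0"
      using w h inj f g by (simp add: inj_on_def word_Nil)
    then show ?thesis
      using trivial_zero by simp
  qed
  show ?thesis
    unfolding groebner_shirshov_basis_def using nonempty monic inter incl by blast
qed

lemma trivial_moduloI:
  assumes "h = (\<Sum>(\<alpha>, a, s, b)\<leftarrow>ts. scale \<alpha> (word a * s * word b))"
    and "\<forall>(\<alpha>, a, s, b)\<in>set ts. s \<in> T \<and> a @ lead_word s @ b < w"
  shows "trivial_modulo T w h"
  using assms unfolding trivial_modulo_def by blast

section \<open>Ideals generated by sets that agree up to sign\<close>

lemma ideal_free_algebra_uminus:
  fixes f :: "('x, 'k::field) ncpoly"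
  assumes "ideal I (free_algebra :: ('k, ('x, 'k) ncpoly) module)" and "f \<in> I"
  shows "- f \<in> I"
proof -
  have "- 1 \<otimes>\<^bsub>free_algebra\<^esub> f \<in> I"
    using ideal.I_l_closed[OF assms, of "- 1"] by (simp add: free_algebra_def)
  then show ?thesis
    by (simp add: free_algebra_def)
qed

lemma gen_ideal_eqI:
  fixes A B :: "('x, 'k::field) ncpoly set"
  assumes "\<And>f. f \<in> A \<Longrightarrow> f \<in> B \<or> - f \<in> B" and "\<And>f. f \<in> B \<Longrightarrow> f \<in> A \<or> - f \<in> A"
  shows "gen_ideal A = gen_ideal B"
proof -
  have step: "D \<subseteq> I"
    if "C \<subseteq> I" "\<And>f. f \<in> D \<Longrightarrow> f \<in> C \<or> - f \<in> C"
      and I: "ideal I (free_algebra :: ('k, ('x, 'k) ncpoly) module)"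
    for C D I
  proof
    fix f assume "f \<in> D"
    then have "f \<in> I \<or> - f \<in> I" using that(1,2) by blast
    then show "f \<in> I" using ideal_free_algebra_uminus[OF I, of "- f"] by auto
  qed
  have "{I. ideal I (free_algebra :: ('k, ('x, 'k) ncpoly) module) \<and> A \<subseteq> I} =
    {I. ideal I free_algebra \<and> B \<subseteq> I}"
    using step[OF _ assms(1)] step[OF _ assms(2)] by blast
  then show ?thesis
    by (simp add: gen_ideal_def genideal_def)
qed

section \<open>The relations of the algebra\<close>

lemmas letter_word_less =
  Cons_less_Cons less_letter_def

context
  fixes p :: "'k::field"
begin

definition s_xx :: "(letter, 'k) ncpoly" where "s_xx = word [X2, X1] - scale p (word [X1, X2])"
definition s_yy :: "(letter, 'k) ncpoly" where "s_yy = word [Y2, Y1] - scale p (word [Y1, Y2])"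
definition s_x2y2 :: "(letter, 'k) ncpoly" where "s_x2y2 = word [X2, Y2] - word [Y1, X1]"
definition s_x1y2 :: "(letter, 'k) ncpoly" where "s_x1y2 = word [X1, Y2] - word [Y1, X2]"
definition s_x2y1 :: "(letter, 'k) ncpoly" where "s_x2y1 = word [X2, Y1] + word [Y2, X1]"
definition s_x1y1 :: "(letter, 'k) ncpoly" where "s_x1y1 = word [X1, Y1] - word [Y2, X2]"

lemmas s_defs = s_xx_def s_yy_def s_x2y2_def s_x1y2_def s_x2y1_def s_x1y1_def

lemma S_set_eq: "S_set p = {s_xx, s_yy, s_x2y2, s_x1y2, s_x2y1, s_x1y1}"
  by (simp add: S_set_def s_defs)

lemma s_lead_word:
  "lead_word s_xx = [X2, X1]" "lead_word s_yy = [Y2, Y1]" "lead_word s_x2y2 = [X2, Y2]"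
  "lead_word s_x1y2 = [X1, Y2]" "lead_word s_x2y1 = [X2, Y1]" "lead_word s_x1y1 = [X1, Y1]"
  using lead_word_binomial[of "[X1, X2]" "[X2, X1]" "- p"]
    lead_word_binomial[of "[Y1, Y2]" "[Y2, Y1]" "- p"]
    lead_word_binomial[of "[Y1, X1]" "[X2, Y2]" "- 1 :: 'k"]
    lead_word_binomial[of "[Y1, X2]" "[X1, Y2]" "- 1 :: 'k"]
    lead_word_binomial[of "[Y2, X1]" "[X2, Y1]" "1 :: 'k"]
    lead_word_binomial[of "[Y2, X2]" "[X1, Y1]" "- 1 :: 'k"]
  by (simp_all add: s_defs letter_word_less scale_minus_left scale_one)

lemma s_monic: "f \<in> S_set p \<Longrightarrow> monic f"
  using monic_binomial[of "[X1, X2]" "[X2, X1]" "- p"]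
    monic_binomial[of "[Y1, Y2]" "[Y2, Y1]" "- p"]
    monic_binomial[of "[Y1, X1]" "[X2, Y2]" "- 1 :: 'k"]
    monic_binomial[of "[Y1, X2]" "[X1, Y2]" "- 1 :: 'k"]
    monic_binomial[of "[Y2, X1]" "[X2, Y1]" "1 :: 'k"]
    monic_binomial[of "[Y2, X2]" "[X1, Y1]" "- 1 :: 'k"]
  by (auto simp: S_set_def letter_word_less scale_minus_left scale_one)

text \<open>
  Each list of terms records the rewriting steps that follow the first step on either branch. A step
  on the branch that starts by rewriting the first two letters enters with the opposite sign, since
  the composition is the second reduct minus the first. All intermediate words cancel, and the normal
  words left over cancel by \<open>p\<^sup>2 = -1\<close>.
\<close>

lemma s_overlaps_trivial:
  assumes "p ^ 2 = -1"
  shows "trivial_modulo (S_set p) [X2, X1, Y2] (s_xx * word [Y2] - word [X2] * s_x1y2)"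
    and "trivial_modulo (S_set p) [X2, X1, Y1] (s_xx * word [Y1] - word [X2] * s_x1y1)"
    and "trivial_modulo (S_set p) [X2, Y2, Y1] (s_x2y2 * word [Y1] - word [X2] * s_yy)"
    and "trivial_modulo (S_set p) [X1, Y2, Y1] (s_x1y2 * word [Y1] - word [X1] * s_yy)"
proof -
  have pp: "p * p = -1" using assms by (simp add: power2_eq_square)
  show "trivial_modulo (S_set p) [X2, X1, Y2] (s_xx * word [Y2] - word [X2] * s_x1y2)"
    by (rule trivial_moduloI[of _ "[(- p, [X1], s_x2y2, []), (- p, [], s_x1y1, [X1]),
          (- p, [Y2], s_xx, []), (1, [], s_x2y1, [X2])]"])
      (simp_all add: S_set_eq s_lead_word letter_word_less, simp add: s_defs word_algebra pp)
  show "trivial_modulo (S_set p) [X2, X1, Y1] (s_xx * word [Y1] - word [X2] * s_x1y1)"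
    by (rule trivial_moduloI[of _ "[(- p, [X1], s_x2y1, []), (p, [], s_x1y2, [X1]),
          (p, [Y1], s_xx, []), (1, [], s_x2y2, [X2])]"])
      (simp_all add: S_set_eq s_lead_word letter_word_less, simp add: s_defs word_algebra pp)
  show "trivial_modulo (S_set p) [X2, Y2, Y1] (s_x2y2 * word [Y1] - word [X2] * s_yy)"
    by (rule trivial_moduloI[of _ "[(- 1, [Y1], s_x1y1, []), (p, [], s_x2y1, [Y2]),
          (- p, [Y2], s_x1y2, []), (- p, [], s_yy, [X2])]"])
      (simp_all add: S_set_eq s_lead_word letter_word_less, simp add: s_defs word_algebra pp)
  show "trivial_modulo (S_set p) [X1, Y2, Y1] (s_x1y2 * word [Y1] - word [X1] * s_yy)"
    by (rule trivial_moduloI[of _ "[(- 1, [Y1], s_x2y1, []), (p, [], s_x1y1, [Y2]),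
          (p, [Y2], s_x2y2, []), (p, [], s_yy, [X1])]"])
      (simp_all add: S_set_eq s_lead_word letter_word_less, simp add: s_defs word_algebra pp)
qed

lemma S_set_groebner_shirshov:
  assumes "p ^ 2 = -1"
  shows "groebner_shirshov_basis (S_set p)"
proof (rule quadratic_groebner_shirshov_basis)
  show "S_set p \<noteq> {}" by (simp add: S_set_def)
  show "monic f" if "f \<in> S_set p" for f using that by (rule s_monic)
  show "length (lead_word f) = 2" if "f \<in> S_set p" for f
    using that by (auto simp: S_set_eq s_lead_word)
  show "inj_on lead_word (S_set p)"
    by (auto simp: inj_on_def S_set_eq s_lead_word)
  show "trivial_modulo (S_set p) [x, y, z] (f * word [z] - word [x] * g)"
    if "f \<in> S_set p" "g \<in> S_set p" "lead_word f = [x, y]" "lead_word g = [y, z]" for f g x y z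
    using that s_overlaps_trivial[OF assms] unfolding S_set_eq by (auto simp: s_lead_word)
qed

lemma gen_ideal_S_set: "gen_ideal (S_set p) = relation_ideal (B_relations p)"
proof -
  have image_eq: "{l - r | l r. (l, r) \<in> B_relations p} = (\<lambda>(l, r). l - r) ` B_relations p"
    by force
  have "{l - r | l r. (l, r) \<in> B_relations p} =
    {s_xx, s_yy, - s_x2y2, - s_x1y2, s_x2y1, - s_x1y1}"
    unfolding image_eq by (simp add: B_relations_def s_defs add.commute)
  then show ?thesis
    unfolding relation_ideal_def S_set_eq by (auto intro!: gen_ideal_eqI)
qed

end

theorem mainTheorem2:
  fixes p :: "'k::field"
  assumes "p ^ 2 = -1"
  shows "groebner_shirshov_basis (S_set p) \<and>
         gen_ideal (S_set p) = relation_ideal (B_relations p) \<and>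
         B_algebra p = quotient_algebra free_algebra (gen_ideal (S_set p))"
  using S_set_groebner_shirshov[OF assms]
  by (simp add: gen_ideal_S_set B_algebra_def presented_algebra_def)

end
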